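(* For $\lambda>0$ let $m^\infty_\lambda$ be the scaling limit (limit in law as $a\searrow0$) of the renormalized magnetization $a^{15/8}\sum_{x\in[0,\lambda]^2\cap a\mathbb Z^2}\sigma_x$ of the critical Ising model in the square $[0,\lambda]^2$, and let $m^\infty:=m^\infty_1$ be the scaling limit of the renormalized magnetization in the unit square $[0,1]^2$ (with the same type of boundary condition, $+$ or free, for all squares). Then, for any $\lambda>0$, one has the identity in law $$m^\infty_\lambda\overset{d}{=}\lambda^{15/8}\,m^\infty .$$
   Context: The critical Ising model in $[0,\lambda]^2\cap a\mathbb Z^2$ has weights proportional to $\exp(\beta_c\sum_{x\sim y}\sigma_x\sigma_y)$, $\sigma_x\in\{-1,+1\}$, $\beta_c=\tfrac12\log(1+\sqrt2)$, zero external field; with $+$ boundary conditions the spins at outside vertices adjacent to the square are set to $+1$, with free boundary conditions there is no interaction with the outside. *)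

theory Defs
  imports "HOL-Probability.Probability"
begin

datatype boundary_condition = Plus | Free

definition lattice :: "real \<Rightarrow> (real \<times> real) set" where
  "lattice a = {(a * of_int i, a * of_int j) | i j. True}"

definition adjacent :: "real \<Rightarrow> real \<times> real \<Rightarrow> real \<times> real \<Rightarrow> bool" where
  "adjacent a x y \<longleftrightarrow> x \<in> lattice a \<and> y \<in> lattice a \<and> dist x y = a"

definition square_sites :: "real \<Rightarrow> real \<Rightarrow> (real \<times> real) set" where
  "square_sites a l = ({0..l} \<times> {0..l}) \<inter> lattice a"

definition outer_boundary :: "real \<Rightarrow> real \<Rightarrow> (real \<times> real) set" where
  "outer_boundary a l =
     {y \<in> lattice a - square_sites a l. \<exists>x \<in> square_sites a l. adjacent a x y}"

text \<open>Edges are unordered pairs, so every pair of neighbours is counted once.\<close>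

fun interaction_edges ::
  "boundary_condition \<Rightarrow> real \<Rightarrow> real \<Rightarrow> (real \<times> real) set set" where
  "interaction_edges Plus a l =
     {{x, y} | x y. x \<in> square_sites a l \<and> y \<in> square_sites a l \<union> outer_boundary a l
                    \<and> adjacent a x y}"
| "interaction_edges Free a l =
     {{x, y} | x y. x \<in> square_sites a l \<and> y \<in> square_sites a l \<and> adjacent a x y}"

definition spin_configs :: "real \<Rightarrow> real \<Rightarrow> (real \<times> real \<Rightarrow> real) set" where
  "spin_configs a l = square_sites a l \<rightarrow>\<^sub>E {- 1, 1}"

text \<open>A configuration is extended by \<open>+1\<close> outside the square. With free boundary conditions no
  edge leaves the square, so the extension is then irrelevant.\<close>

definition extended_spin ::
  "real \<Rightarrow> real \<Rightarrow> (real \<times> real \<Rightarrow> real) \<Rightarrow> real \<times> real \<Rightarrow> real" where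
  "extended_spin a l \<sigma> x = (if x \<in> square_sites a l then \<sigma> x else 1)"

definition critical_beta :: real where
  "critical_beta = 1 / 2 * ln (1 + sqrt 2)"

text \<open>For an edge \<open>e = {x, y}\<close> with \<open>x \<noteq> y\<close>, the product over \<open>e\<close> is
  \<open>\<sigma> x * \<sigma> y\<close>.\<close>

definition ising_weight ::
  "boundary_condition \<Rightarrow> real \<Rightarrow> real \<Rightarrow> (real \<times> real \<Rightarrow> real) \<Rightarrow> real" where
  "ising_weight bc a l \<sigma> =
     exp (critical_beta *
       (\<Sum>e \<in> interaction_edges bc a l. \<Prod>x\<in>e. extended_spin a l \<sigma> x))"

definition ising_measure ::
  "boundary_condition \<Rightarrow> real \<Rightarrow> real \<Rightarrow> (real \<times> real \<Rightarrow> real) measure" where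
  "ising_measure bc a l =
     point_measure (spin_configs a l)
       (\<lambda>\<sigma>. ennreal (ising_weight bc a l \<sigma> / (\<Sum>\<tau> \<in> spin_configs a l. ising_weight bc a l \<tau>)))"

definition renormalized_magnetization ::
  "real \<Rightarrow> real \<Rightarrow> (real \<times> real \<Rightarrow> real) \<Rightarrow> real" where
  "renormalized_magnetization a l \<sigma> = a powr (15 / 8) * (\<Sum>x \<in> square_sites a l. \<sigma> x)"

text \<open>Convergence in law along the mesh size \<open>a\<close> tending to \<open>0\<close> from above, expressed through all
  sequences of mesh sizes because \<^const>\<open>weak_conv_m\<close> is a notion for sequences.\<close>

definition is_magnetization_scaling_limit ::
  "boundary_condition \<Rightarrow> real \<Rightarrow> 'w measure \<Rightarrow> ('w \<Rightarrow> real) \<Rightarrow> bool" where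
  "is_magnetization_scaling_limit bc l M m \<longleftrightarrow>
     prob_space M \<and> m \<in> borel_measurable M \<and>
     (\<forall>a :: nat \<Rightarrow> real. filterlim a (at_right 0) sequentially \<longrightarrow>
        weak_conv_m
          (\<lambda>n. distr (ising_measure bc (a n) l) borel (renormalized_magnetization (a n) l))
          (distr M borel m))"

end

theory Submission
  imports Defs
begin

text \<open>Scaling the plane by \<open>c\<close> carries the Ising model of mesh \<open>a\<close> in a square of side \<open>s\<close> exactly onto
  that of mesh \<open>c a\<close> in a square of side \<open>c s\<close>, and multiplies the renormalized magnetization by
  \<open>c powr (15 / 8)\<close>. Along the mesh sizes \<open>1/(n + 1)\<close> and \<open>l/(n + 1)\<close> both limits are therefore computed
  from the same laws, and characteristic functions identify them.\<close>

section \<open>Dilation of sites, boundary and edges\<close>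

lemma ex_scaleR_iff:
  fixes P :: "'a::real_vector \<Rightarrow> bool"
  assumes "c \<noteq> 0"
  shows "(\<exists>x. P x) \<longleftrightarrow> (\<exists>x. P (c *\<^sub>R x))"
proof
  assume "\<exists>x. P x"
  then obtain x where "P x" ..
  then have "P (c *\<^sub>R (x /\<^sub>R c))"
    using assms by simp
  then show "\<exists>x. P (c *\<^sub>R x)" ..
qed blast

lemma scaleR_mem_lattice:
  assumes "c \<noteq> 0"
  shows "c *\<^sub>R x \<in> lattice (c * a) \<longleftrightarrow> x \<in> lattice a"
  using assms by (cases x) (auto simp: lattice_def)

lemma adjacent_scaleR:
  assumes "c > 0"
  shows "adjacent (c * a) (c *\<^sub>R x) (c *\<^sub>R y) \<longleftrightarrow> adjacent a x y"
  using assms by (simp add: adjacent_def scaleR_mem_lattice dist_norm flip: scaleR_right_diff_distrib)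

lemma scaleR_mem_square_sites:
  assumes "c > 0"
  shows "c *\<^sub>R x \<in> square_sites (c * a) (c * s) \<longleftrightarrow> x \<in> square_sites a s"
  using assms
  \<comment> \<open>The simplifier distributes \<open>scaleR\<close> over the two coordinates of the
    pair, so the lattice fact is first put into the same coordinate form.\<close>
  by (cases x) (simp add: square_sites_def scaleR_mem_lattice[of c "(_, _)", simplified] zero_le_mult_iff)

lemma scaleR_mem_outer_boundary:
  assumes "c > 0"
  shows "c *\<^sub>R y \<in> outer_boundary (c * a) (c * s) \<longleftrightarrow> y \<in> outer_boundary a s"
  \<comment> \<open>The inner neighbour that witnesses membership in the boundary is reparametrized
    as a dilated point, so that both of its conditions can be pulled back.\<close>
  using assms ex_scaleR_iff[of c "\<lambda>x. x \<in> square_sites (c * a) (c * s) \<and> adjacent (c * a) x (c *\<^sub>R y)"]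
  by (simp add: outer_boundary_def Bex_def scaleR_mem_lattice scaleR_mem_square_sites adjacent_scaleR)

lemma square_sites_scale:
  assumes "c > 0"
  shows "square_sites (c * a) (c * s) = scaleR c ` square_sites a s"
proof (rule set_eqI)
  fix x :: "real \<times> real"
  have "x = c *\<^sub>R (x /\<^sub>R c)"
    using assms by simp
  then show "x \<in> square_sites (c * a) (c * s) \<longleftrightarrow> x \<in> scaleR c ` square_sites a s"
    using assms scaleR_mem_square_sites by (metis (no_types, lifting) imageE imageI)
qed

text \<open>Every point is the dilation of a unique point, so every unordered pair is the image of a
  pair. Keeping \<open>P\<close> arbitrary lets both boundary conditions be treated as
  instances.\<close>

lemma pair_set_scaleR:
  fixes P :: "'a::real_vector \<Rightarrow> 'a \<Rightarrow> bool"
  assumes "c \<noteq> 0"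
  shows "{{x, y} | x y. P x y} = image (scaleR c) ` {{x, y} | x y. P (c *\<^sub>R x) (c *\<^sub>R y)}"
proof (intro equalityI subsetI)
  fix e assume "e \<in> {{x, y} | x y. P x y}"
  then obtain x y where e: "e = {x, y}" "P x y"
    by blast
  have x: "x = c *\<^sub>R (x /\<^sub>R c)" and y: "y = c *\<^sub>R (y /\<^sub>R c)"
    using assms by simp_all
  have "e = scaleR c ` {x /\<^sub>R c, y /\<^sub>R c}"
    using e x y by simp
  moreover have "{x /\<^sub>R c, y /\<^sub>R c} \<in> {{x, y} | x y. P (c *\<^sub>R x) (c *\<^sub>R y)}"
    using e(2) unfolding mem_Collect_eq by (metis x y)
  ultimately show "e \<in> image (scaleR c) ` {{x, y} | x y. P (c *\<^sub>R x) (c *\<^sub>R y)}"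
    by (rule image_eqI)
next
  fix e assume "e \<in> image (scaleR c) ` {{x, y} | x y. P (c *\<^sub>R x) (c *\<^sub>R y)}"
  then obtain x y where "e = scaleR c ` {x, y}" "P (c *\<^sub>R x) (c *\<^sub>R y)"
    by blast
  then show "e \<in> {{x, y} | x y. P x y}"
    by auto
qed

lemma interaction_edges_scale:
  assumes "c > 0"
  shows "interaction_edges bc (c * a) (c * s) = image (scaleR c) ` interaction_edges bc a s"
  using assms
  by (cases bc; simp only: interaction_edges.simps; subst pair_set_scaleR[of c])
    (simp_all add: scaleR_mem_square_sites scaleR_mem_outer_boundary adjacent_scaleR)

section \<open>Transport of configurations, energy and magnetization\<close>

definition scale_config :: "real \<Rightarrow> real \<Rightarrow> real \<Rightarrow> (real \<times> real \<Rightarrow> real) \<Rightarrow> real \<times> real \<Rightarrow> real" where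
  "scale_config c a s \<sigma> = (\<lambda>x \<in> square_sites (c * a) (c * s). \<sigma> (x /\<^sub>R c))"

lemma scale_config_scaleR:
  assumes "c > 0" "x \<in> square_sites a s"
  shows "scale_config c a s \<sigma> (c *\<^sub>R x) = \<sigma> x"
  using assms by (simp add: scale_config_def scaleR_mem_square_sites)

text \<open>The inverse is the pullback along the dilation. Restricting both maps keeps the values
  outside the squares at \<open>undefined\<close>, so the maps are inverse to each other as
  functions and not merely on the sites.\<close>

lemma bij_betw_scale_config:
  assumes "c > 0"
  shows "bij_betw (scale_config c a s) (spin_configs a s) (spin_configs (c * a) (c * s))"
proof (rule bij_betwI[where g = "\<lambda>\<tau>. \<lambda>x \<in> square_sites a s. \<tau> (c *\<^sub>R x)"])
  show "scale_config c a s \<in> spin_configs a s \<rightarrow> spin_configs (c * a) (c * s)"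
    using assms by (auto simp: spin_configs_def scale_config_def square_sites_scale PiE_iff)
  show "(\<lambda>\<tau>. \<lambda>x \<in> square_sites a s. \<tau> (c *\<^sub>R x)) \<in> spin_configs (c * a) (c * s) \<rightarrow> spin_configs a s"
    using assms by (auto simp: spin_configs_def square_sites_scale PiE_iff)
next
  fix \<sigma> assume \<sigma>: "\<sigma> \<in> spin_configs a s"
  have "(\<lambda>x \<in> square_sites a s. scale_config c a s \<sigma> (c *\<^sub>R x)) = restrict \<sigma> (square_sites a s)"
    using assms by (intro restrict_ext scale_config_scaleR)
  also have "\<dots> = \<sigma>"
    using \<sigma> unfolding spin_configs_def by (rule PiE_restrict)
  finally show "(\<lambda>x \<in> square_sites a s. scale_config c a s \<sigma> (c *\<^sub>R x)) = \<sigma>" .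
next
  fix \<tau> assume \<tau>: "\<tau> \<in> spin_configs (c * a) (c * s)"
  have "scale_config c a s (\<lambda>x \<in> square_sites a s. \<tau> (c *\<^sub>R x))
      = restrict \<tau> (square_sites (c * a) (c * s))"
    unfolding scale_config_def
  proof (rule restrict_ext)
    fix x assume "x \<in> square_sites (c * a) (c * s)"
    then obtain y where "x = c *\<^sub>R y" "y \<in> square_sites a s"
      using assms by (metis square_sites_scale imageE)
    then show "(\<lambda>x \<in> square_sites a s. \<tau> (c *\<^sub>R x)) (x /\<^sub>R c) = \<tau> x"
      using assms by simp
  qed
  also have "\<dots> = \<tau>"
    using \<tau> unfolding spin_configs_def by (rule PiE_restrict)
  finally show "scale_config c a s (\<lambda>x \<in> square_sites a s. \<tau> (c *\<^sub>R x)) = \<tau>" .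
qed

text \<open>Dilation also preserves the complement of the square, where both sides are 1. Hence no
  membership condition on \<open>x\<close> is needed, and edges reaching the plus boundary are
  covered.\<close>

lemma extended_spin_scale:
  assumes "c > 0"
  shows "extended_spin (c * a) (c * s) (scale_config c a s \<sigma>) (c *\<^sub>R x) = extended_spin a s \<sigma> x"
  using assms by (simp add: extended_spin_def scaleR_mem_square_sites scale_config_scaleR)

text \<open>The energy sees the mesh only through the graph of edges, and the dilation is a graph
  isomorphism; the inverse temperature stays at its critical value.\<close>

lemma ising_weight_scale:
  assumes "c > 0"
  shows "ising_weight bc (c * a) (c * s) (scale_config c a s \<sigma>) = ising_weight bc a s \<sigma>"
proof -
  have inj: "inj (scaleR c :: real \<times> real \<Rightarrow> _)"
    using assms by (simp add: inj_on_def)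
  \<comment> \<open>Injectivity is used twice: on edges to reindex the sum, and on points to reindex
    the product over the endpoints of each edge.\<close>
  then have "inj_on (image (scaleR c)) (interaction_edges bc a s)"
    by (auto intro: inj_onI simp: inj_image_eq_iff)
  moreover have "(\<Prod>x\<in>scaleR c ` e. extended_spin (c * a) (c * s) (scale_config c a s \<sigma>) x)
      = (\<Prod>x\<in>e. extended_spin a s \<sigma> x)" for e
    using assms inj by (subst prod.reindex) (auto simp: extended_spin_scale inj_on_def)
  ultimately show ?thesis
    by (simp add: ising_weight_def interaction_edges_scale[OF assms] sum.reindex)
qed

text \<open>The sum of spins is unchanged; the whole factor comes from the prefactor
  \<open>(c * a) powr (15 / 8)\<close>.\<close>

lemma renormalized_magnetization_scale:
  assumes "c > 0" "a > 0"
  shows "renormalized_magnetization (c * a) (c * s) (scale_config c a s \<sigma>)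
    = c powr (15 / 8) * renormalized_magnetization a s \<sigma>"
proof -
  have "(\<Sum>x \<in> square_sites (c * a) (c * s). scale_config c a s \<sigma> x) = (\<Sum>x \<in> square_sites a s. \<sigma> x)"
    unfolding square_sites_scale[OF assms(1)]
    using assms by (subst sum.reindex) (auto simp: inj_on_def scale_config_scaleR)
  then show ?thesis
    using assms by (simp add: renormalized_magnetization_def powr_mult)
qed

section \<open>The Ising measure and its image under dilation\<close>

lemma finite_square_sites:
  assumes "a > 0"
  shows "finite (square_sites a s)"
proof (rule finite_subset)
  show "square_sites a s \<subseteq> (\<lambda>(i, j). (a * of_int i, a * of_int j)) ` ({0..\<lfloor>s / a\<rfloor>} \<times> {0..\<lfloor>s / a\<rfloor>})"
    using assms
    by (auto simp: square_sites_def lattice_def zero_le_mult_iff le_floor_iff field_simps)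
qed simp

lemma finite_spin_configs: "a > 0 \<Longrightarrow> finite (spin_configs a s)"
  by (simp add: spin_configs_def finite_PiE finite_square_sites)

lemma spin_configs_nonempty: "spin_configs a s \<noteq> {}"
  by (auto simp: spin_configs_def PiE_eq_empty_iff)

lemma prob_space_ising_measure:
  assumes "a > 0"
  shows "prob_space (ising_measure bc a s)"
proof -
  define Z where "Z = (\<Sum>\<tau> \<in> spin_configs a s. ising_weight bc a s \<tau>)"
  have pos: "ising_weight bc a s \<sigma> > 0" for \<sigma>
    by (simp add: ising_weight_def)
  then have "Z > 0"
    unfolding Z_def using assms by (intro sum_pos finite_spin_configs spin_configs_nonempty)
  then have "(\<Sum>\<sigma> \<in> spin_configs a s. ennreal (ising_weight bc a s \<sigma> / Z)) = 1"
    using pos by (subst sum_ennreal) (auto simp: less_imp_le simp flip: sum_divide_distrib Z_def)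
  then show ?thesis
    using finite_spin_configs[OF assms] unfolding ising_measure_def
    by (intro prob_spaceI) (simp add: space_point_measure emeasure_point_measure_finite Z_def)
qed

lemma measurable_ising_measure [measurable]: "f \<in> borel_measurable (ising_measure bc a s)"
  by (simp add: ising_measure_def)

text \<open>The bijection of configurations preserves weights, hence also the partition function, so
  point masses agree. The second argument of \<open>distr\<close> supplies only the space and its
  measurable sets, so the equation is not circular.\<close>

lemma ising_measure_scale:
  assumes "c > 0" "a > 0"
  shows "ising_measure bc (c * a) (c * s)
    = distr (ising_measure bc a s) (ising_measure bc (c * a) (c * s)) (scale_config c a s)"
proof -
  let ?A = "spin_configs a s" and ?B = "spin_configs (c * a) (c * s)" and ?\<phi> = "scale_config c a s"
  note bij = bij_betw_scale_config[OF assms(1), of a s]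
  have fin: "finite ?A" "finite ?B"
    using assms by (simp_all add: finite_spin_configs)
  have Z: "(\<Sum>\<tau> \<in> ?B. ising_weight bc (c * a) (c * s) \<tau>) = (\<Sum>\<tau> \<in> ?A. ising_weight bc a s \<tau>)"
    using assms(1) by (simp add: ising_weight_scale flip: sum.reindex_bij_betw[OF bij])
  show ?thesis
  proof (rule measure_eqI)
    fix X assume "X \<in> sets (ising_measure bc (c * a) (c * s))"
    then have X: "X \<subseteq> ?B"
      by (simp add: ising_measure_def sets_point_measure)
    have bijX: "bij_betw ?\<phi> (?\<phi> -` X \<inter> ?A) X"
    proof (rule bij_betw_subset[OF bij])
      have "X \<subseteq> ?\<phi> ` ?A"
        using X by (simp only: bij_betw_imp_surj_on[OF bij])
      then show "?\<phi> ` (?\<phi> -` X \<inter> ?A) = X"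
        by blast
    qed simp
    have \<phi>: "?\<phi> \<in> measurable (ising_measure bc a s) (ising_measure bc (c * a) (c * s))"
      using bij by (auto simp: ising_measure_def space_point_measure bij_betw_def)
    have "emeasure (ising_measure bc (c * a) (c * s)) X = emeasure (ising_measure bc a s) (?\<phi> -` X \<inter> ?A)"
      using fin X Z assms(1)
      by (simp add: ising_measure_def emeasure_point_measure_finite ising_weight_scale
          flip: sum.reindex_bij_betw[OF bijX])
    then show "emeasure (ising_measure bc (c * a) (c * s)) X
        = emeasure (distr (ising_measure bc a s) (ising_measure bc (c * a) (c * s)) ?\<phi>) X"
      using \<phi> X by (simp add: emeasure_distr ising_measure_def sets_point_measure space_point_measure)
  qed simp
qed

section \<open>Laws of the magnetization and passage to the limit\<close>

lemma magnetization_law_scale: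
  assumes "c > 0" "a > 0"
  shows "distr (ising_measure bc (c * a) (c * s)) borel (renormalized_magnetization (c * a) (c * s))
    = distr (distr (ising_measure bc a s) borel (renormalized_magnetization a s)) borel
        (\<lambda>x. c powr (15 / 8) * x)"
proof -
  have "scale_config c a s \<in> measurable (ising_measure bc a s) (ising_measure bc (c * a) (c * s))"
    using bij_betw_scale_config[OF assms(1), of a s]
    by (auto simp: ising_measure_def space_point_measure bij_betw_def)
  then show ?thesis
    by (subst ising_measure_scale[OF assms])
      (simp add: distr_distr comp_def renormalized_magnetization_scale[OF assms])
qed

text \<open>Moving the factor from the variable to the argument turns convergence of the unscaled
  laws at \<open>t * c\<close> into convergence of the scaled laws at \<open>t\<close>.\<close>

lemma char_distr_mult:
  assumes "real_distribution N"
  shows "char (distr N borel (\<lambda>x. c * x)) t = char N (t * c)"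
proof -
  interpret real_distribution N by fact
  show ?thesis
    by (simp add: char_def integral_distr mult.assoc)
qed

theorem corollary1p9:
  fixes bc :: boundary_condition and l :: real
    and M_l :: "'v measure" and m_l :: "'v \<Rightarrow> real"
    and M :: "'w measure" and m :: "'w \<Rightarrow> real"
  assumes "l > 0"
    and "is_magnetization_scaling_limit bc l M_l m_l"
    and "is_magnetization_scaling_limit bc 1 M m"
  shows "distr M_l borel m_l = distr M borel (\<lambda>\<omega>. l powr (15 / 8) * m \<omega>)"
proof -
  define c where "c = l powr (15 / 8)"
  \<comment> \<open>\<open>Suc n\<close> keeps every mesh positive, including the one at
    \<open>n = 0\<close>; the scaling lemmas and the filter \<open>at_right 0\<close> rely on
    this.\<close>
  define a where "a n = 1 / real (Suc n)" for n
  have a_pos: "a n > 0" for n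
    by (simp add: a_def)
  have "a \<longlonglongrightarrow> 0"
    unfolding a_def by (rule LIMSEQ_Suc[OF lim_1_over_n])
  then have lim: "filterlim a (at_right 0) sequentially"
    "filterlim (\<lambda>n. l * a n) (at_right 0) sequentially"
    using a_pos[THEN less_imp_neq] a_pos \<open>l > 0\<close>
    by (auto simp: filterlim_at intro!: tendsto_mult_right_zero)
  define D where "D n = distr (ising_measure bc (a n) 1) borel (renormalized_magnetization (a n) 1)" for n
  have meas [measurable]: "m \<in> borel_measurable M" "m_l \<in> borel_measurable M_l"
    and prob: "prob_space M" "prob_space M_l"
    using assms by (auto simp: is_magnetization_scaling_limit_def)
  have D: "real_distribution (D n)" for n
    unfolding D_def using prob_space_ising_measure[OF a_pos]
    by (simp add: prob_space.real_distribution_distr)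
  have Dc: "real_distribution (distr (D n) borel ((*) c))" for n
  proof -
    interpret real_distribution "D n" by (rule D)
    show ?thesis
      by (rule real_distribution_distr) simp
  qed
  have dist: "real_distribution (distr M borel m)" "real_distribution (distr M_l borel m_l)"
    using prob by (simp_all add: prob_space.real_distribution_distr)
  have cm: "distr M borel (\<lambda>\<omega>. c * m \<omega>) = distr (distr M borel m) borel ((*) c)"
    by (simp add: distr_distr comp_def)
  have "weak_conv_m D (distr M borel m)"
    using assms(3) lim(1) unfolding D_def is_magnetization_scaling_limit_def by blast
  then have conv1: "(\<lambda>n. char (D n) t) \<longlonglongrightarrow> char (distr M borel m) t" for t
    by (rule levy_continuity1[OF D dist(1)])
  \<comment> \<open>The limit in the square of side \<open>l = l * 1\<close> is taken along the
    meshes \<open>l * a n\<close>, whose laws are exactly the dilated laws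
    \<open>D n\<close>.\<close>
  have "weak_conv_m (\<lambda>n. distr (D n) borel ((*) c)) (distr M_l borel m_l)"
    using assms(2) lim(2) magnetization_law_scale[OF \<open>l > 0\<close> a_pos, of bc _ 1]
    unfolding D_def c_def is_magnetization_scaling_limit_def by fastforce
  then have convl: "(\<lambda>n. char (distr (D n) borel ((*) c)) t) \<longlonglongrightarrow> char (distr M_l borel m_l) t" for t
    by (rule levy_continuity1[OF Dc dist(2)])
  have "distr M_l borel m_l = distr M borel (\<lambda>\<omega>. c * m \<omega>)"
  proof (rule Levy_uniqueness[OF dist(2)])
    show "real_distribution (distr M borel (\<lambda>\<omega>. c * m \<omega>))"
      using prob(1) by (simp add: prob_space.real_distribution_distr)
    show "char (distr M_l borel m_l) = char (distr M borel (\<lambda>\<omega>. c * m \<omega>))"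
    proof
      fix t
      show "char (distr M_l borel m_l) t = char (distr M borel (\<lambda>\<omega>. c * m \<omega>)) t"
        \<comment> \<open>After rewriting, both limits concern the same numerical sequence
          \<open>char (D n) (t * c)\<close>.\<close>
        using LIMSEQ_unique[OF convl[of t, unfolded char_distr_mult[OF D]] conv1[of "t * c"]]
        by (simp only: cm char_distr_mult[OF dist(1)])
    qed
  qed
  then show ?thesis
    by (simp only: c_def)
qed

end
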